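(* Let $\alpha>0$ and $n\in\{0,1,2,\ldots\}$. The auxiliary quantities $r_n(t)$ and $R_n(t)$ associated with the weight $w(x,t)=(1-x^2)^\alpha e^{-t/(1-x^2)}$ on $[-1,1]$ satisfy, for all $t>0$, the coupled Riccati equations (prime $=d/dt$) $$2t\,r_n'(t)=2nt-r_n^2(t)+2(n+\alpha+1-t)r_n(t)-\frac{2(2n+1+2\alpha)\left(r_n^2(t)+2t\,r_n(t)\right)}{R_n(t)},$$ $$2t\,R_n'(t)=R_n^2(t)+2(n+\alpha+1-t)R_n(t)-2r_n(t)\left(2n+1+2\alpha+R_n(t)\right)-2t(2n+1+2\alpha).$$
   Context: Fix $\alpha>0$. For $t>0$ let $w(x,t):=(1-x^2)^\alpha e^{-t/(1-x^2)}$, $x\in[-1,1]$, and let $P_n(x,t)$, $n=0,1,2,\ldots$, be the monic polynomials of degree $n$ with $\int_{-1}^1 P_m(x,t)P_n(x,t) w(x,t)\,dx=h_n(t)\delta_{mn}$. The auxiliary quantities are $$R_n(t):=\frac{2t}{h_n(t)}\int_{-1}^1\frac{1}{1-y^2}P_n^2(y,t)w(y,t)\,dy,\qquad r_n(t):=\frac{2t}{h_{n-1}(t)}\int_{-1}^1\frac{y}{1-y^2}P_n(y,t)P_{n-1}(y,t)w(y,t)\,dy,$$ with $r_0(t)=0$. *)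

theory Defs
  imports "HOL-Analysis.Analysis" "HOL-Computational_Algebra.Polynomial"
begin

(* At x = 1 and x = -1 the conventions z / 0 = 0 and 0 powr a = 0 give the value 0,
   which is the limit of the weight there when t > 0. *)
definition weight :: "real \<Rightarrow> real \<Rightarrow> real \<Rightarrow> real" where
  "weight \<alpha> x t = (1 - x\<^sup>2) powr \<alpha> * exp (- t / (1 - x\<^sup>2))"

(* "integral" is the gauge integral; it agrees with the Lebesgue integral in this file, because
   for t > 0 all the integrands are continuous on [-1,1]. *)
definition monic_orthogonal ::
    "real \<Rightarrow> real \<Rightarrow> (nat \<Rightarrow> real poly) \<Rightarrow> (nat \<Rightarrow> real) \<Rightarrow> bool" where
  "monic_orthogonal \<alpha> t p h \<longleftrightarrow>
     (\<forall>n. degree (p n) = n \<and> lead_coeff (p n) = 1) \<and>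
     (\<forall>m n. integral {-1..1} (\<lambda>x. poly (p m) x * poly (p n) x * weight \<alpha> x t)
             = (if m = n then h n else 0))"

definition R_aux ::
    "real \<Rightarrow> (nat \<Rightarrow> real \<Rightarrow> real poly) \<Rightarrow> (nat \<Rightarrow> real \<Rightarrow> real) \<Rightarrow> nat \<Rightarrow> real \<Rightarrow> real" where
  "R_aux \<alpha> P h n t =
     2 * t / h n t *
       integral {-1..1} (\<lambda>y. 1 / (1 - y\<^sup>2) * (poly (P n t) y)\<^sup>2 * weight \<alpha> y t)"

definition r_aux ::
    "real \<Rightarrow> (nat \<Rightarrow> real \<Rightarrow> real poly) \<Rightarrow> (nat \<Rightarrow> real \<Rightarrow> real) \<Rightarrow> nat \<Rightarrow> real \<Rightarrow> real" where
  "r_aux \<alpha> P h n t =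
     (if n = 0 then 0
      else 2 * t / h (n - 1) t *
        integral {-1..1}
          (\<lambda>y. y / (1 - y\<^sup>2) * poly (P n t) y * poly (P (n - 1) t) y * weight \<alpha> y t))"

end

theory Submission
  imports Defs
begin

text \<open>
  Write \<open>\<langle>f\<rangle>\<close> for the integral of \<open>f\<close> against the weight and \<open>u = 1 / (1 - x\<^sup>2)\<close>, so that \<open>\<partial>\<^sub>t \<langle>f\<rangle> = - \<langle>u f\<rangle>\<close> for
  fixed \<open>f\<close>, and let \<open>p = P\<^sub>n\<close>, \<open>q = P\<^sub>n\<^sub>-\<^sub>1\<close>, \<open>\<beta> = h\<^sub>n / h\<^sub>n\<^sub>-\<^sub>1\<close>, \<open>S = R\<^sub>n\<^sub>-\<^sub>1\<close>. Orthogonality turns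
  \<open>\<langle>u p f\<rangle>\<close>, for \<open>f\<close> of degree at most \<open>n + 1\<close> and of the parity of \<open>n\<close>, into a constant times \<open>f(1)\<close>;
  comparing such values gives \<open>\<beta> R\<^sub>n S = r\<^sub>n (r\<^sub>n + 2 t)\<close> and one compatibility relation between
  \<open>\<beta>\<close>, \<open>R\<^sub>n\<close>, \<open>S\<close> and \<open>r\<^sub>n\<close>, which together remove \<open>\<beta>\<close> and \<open>S\<close> from the equation for \<open>r\<^sub>n\<close>. Differentiating the
  orthogonality relations identifies \<open>2 t (1 - x\<^sup>2) \<partial>\<^sub>t p = \<beta> R\<^sub>n x q - r\<^sub>n p\<close>. Hence the \<open>t\<close>-derivatives of
  \<open>\<langle>u p\<^sup>2\<rangle>\<close> and \<open>\<langle>u x p q\<rangle>\<close> reduce to integrals with \<open>u\<^sup>2\<close>, and these are found from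
  \<open>\<langle>(x p\<^sup>2)'\<rangle>\<close> and \<open>\<langle>(p q)'\<rangle>\<close> by integration by parts.
\<close>

section \<open>The weight and its integrals\<close>

text \<open>The inequality \<open>(1 + z / m) ^ m \<le> exp z\<close> at \<open>z = t / y\<close>
  lets the exponential beat every power of \<open>y\<close>, negative ones included. The constant
  depends on \<open>\<delta>\<close> but not on \<open>t\<close>.\<close>

lemma powr_mult_exp_le:
  fixes a \<delta> t y :: real and m :: nat
  assumes "0 < \<delta>" "\<delta> \<le> t" "0 < y" "y \<le> 1" "m > 0" "1 \<le> a + real m"
  shows "y powr a * exp (- t / y) \<le> (real m / \<delta>) ^ m * y"
proof -
  have "(t / y / real m) ^ m \<le> (1 + t / y / real m) ^ m"
    using assms by (intro power_mono) auto
  also have "\<dots> \<le> exp (t / y)"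
    using assms by (intro exp_ge_one_plus_x_over_n_power_n) (auto intro: order_trans[of _ 0])
  finally have "exp (- t / y) \<le> inverse ((t / y / real m) ^ m)"
    using assms by (simp add: exp_minus le_imp_inverse_le)
  also have "\<dots> = (real m / t) ^ m * y ^ m"
    by (simp add: power_divide power_mult_distrib field_simps)
  also have "\<dots> \<le> (real m / \<delta>) ^ m * y ^ m"
    using assms by (intro mult_right_mono power_mono divide_left_mono) auto
  finally have "y powr a * exp (- t / y) \<le> y powr a * ((real m / \<delta>) ^ m * y powr real m)"
    using assms by (intro mult_left_mono) (auto simp: powr_realpow)
  also have "\<dots> = (real m / \<delta>) ^ m * y powr (a + real m)"
    by (simp add: powr_add mult_ac)
  also have "\<dots> \<le> (real m / \<delta>) ^ m * y powr 1"
    using assms by (intro mult_left_mono powr_mono') auto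
  finally show ?thesis using assms by simp
qed

lemma weight_nonneg: "weight a x t \<ge> 0"
  by (simp add: weight_def)

lemma weight_endpoint [simp]: "x\<^sup>2 = 1 \<Longrightarrow> weight a x t = 0"
  by (simp add: weight_def)

lemma weight_minus [simp]: "weight a (- x) t = weight a x t"
  by (simp add: weight_def)

lemma weight_pos: "\<bar>x\<bar> < 1 \<Longrightarrow> weight a x t > 0"
  using abs_square_less_1[of x] by (simp add: weight_def)

lemma weight_add_one:
  assumes "\<bar>x\<bar> \<le> 1"
  shows "weight (a + 1) x t = (1 - x\<^sup>2) * weight a x t"
proof -
  have "x\<^sup>2 \<le> 1" using assms abs_le_square_iff[of x 1] by simp
  then show ?thesis by (simp add: weight_def powr_add mult_ac)
qed

text \<open>At the endpoints both sides are 0, the right one because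
  \<open>0 / 0 = 0\<close>.\<close>

lemma weight_minus_one:
  assumes "\<bar>x\<bar> \<le> 1"
  shows "weight (a - 1) x t = weight a x t / (1 - x\<^sup>2)"
  using weight_add_one[OF assms, of "a - 1" t] by (cases "x\<^sup>2 = 1") auto

lemma square_lt_1_or_eq_1:
  fixes x :: real
  assumes "\<bar>x\<bar> \<le> 1"
  obtains "\<bar>x\<bar> < 1" "x\<^sup>2 < 1" | "x\<^sup>2 = 1"
  using assms abs_square_less_1[of x] abs_square_eq_1[of x] by (cases "\<bar>x\<bar> = 1") auto

text \<open>Joint continuity is what differentiation under the integral sign requires. Only
  \<open>x = 1\<close> and \<open>x = -1\<close> call for an estimate.\<close>

lemma continuous_on_weight_prod:
  "continuous_on ({0<..} \<times> {-1..1}) (\<lambda>(t, x). weight a x t)"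
  unfolding continuous_on_def
proof
  fix z :: "real \<times> real" assume z: "z \<in> {0<..} \<times> {-1..1}"
  obtain t0 x0 where z0: "z = (t0, x0)" "t0 > 0" "\<bar>x0\<bar> \<le> 1" using z by (cases z) auto
  let ?F = "at z within {0<..} \<times> {-1..1}"
  have t: "(fst \<longlongrightarrow> t0) ?F" and x: "(snd \<longlongrightarrow> x0) ?F"
    using tendsto_fst[OF tendsto_ident_at, of z] tendsto_snd[OF tendsto_ident_at, of z]
    by (simp_all add: z0)
  from \<open>\<bar>x0\<bar> \<le> 1\<close> show "((\<lambda>(t, x). weight a x t) \<longlongrightarrow> (case z of (t, x) \<Rightarrow> weight a x t)) ?F"
  proof (cases rule: square_lt_1_or_eq_1)
    case 1
    then show ?thesis unfolding weight_def case_prod_beta z0(1) fst_conv snd_conv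
      by (intro tendsto_intros t[unfolded z0(1)] x[unfolded z0(1)]) auto
  next
    case 2
    \<comment> \<open>This \<open>m\<close> meets the demands of \<open>powr_mult_exp_le\<close>;
      \<open>t0 / 2\<close> plays the part of \<open>\<delta>\<close>, since nearby parameters
      exceed it.\<close>
    obtain m :: nat where m: "real m \<ge> max 1 (1 - a)"
      using real_arch_simple by blast
    let ?C = "(real m / (t0 / 2)) ^ m"
    have "\<forall>\<^sub>F y in ?F. fst y > t0 / 2"
      using order_tendstoD(1)[OF t, of "t0 / 2"] z0 by simp
    moreover have "\<forall>\<^sub>F y in ?F. y \<in> {0<..} \<times> {-1..1}"
      by (simp add: eventually_at_filter)
    ultimately have "\<forall>\<^sub>F y in ?F. norm (case y of (t, x) \<Rightarrow> weight a x t) \<le> ?C * (1 - (snd y)\<^sup>2)"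
    proof eventually_elim
      case (elim y)
      obtain t x where y: "y = (t, x)" by (cases y)
      have "\<bar>x\<bar> \<le> 1" using elim y by auto
      then show ?case
      proof (cases rule: square_lt_1_or_eq_1)
        case 1
        then have "weight a x t \<le> ?C * (1 - x\<^sup>2)"
          unfolding weight_def using elim y z0 m by (intro powr_mult_exp_le) auto
        then show ?thesis by (simp add: y weight_nonneg)
      qed (use y in auto)
    qed
    moreover have "((\<lambda>y. ?C * (1 - (snd y)\<^sup>2)) \<longlongrightarrow> ?C * (1 - x0\<^sup>2)) ?F"
      by (intro tendsto_intros x)
    ultimately show ?thesis
      using 2 z0 by (auto intro: Lim_null_comparison)
  qed
qed

lemma continuous_on_weight:
  assumes "t > 0"
  shows "continuous_on {-1..1} (\<lambda>x. weight a x t)"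
proof -
  have "continuous_on {-1..1} ((\<lambda>(t, x). weight a x t) \<circ> Pair t)"
    using assms
    by (intro continuous_on_compose continuous_on_subset[OF continuous_on_weight_prod]
        continuous_intros) auto
  then show ?thesis by (simp add: o_def)
qed

lemma has_real_derivative_weight_param:
  assumes "\<bar>x\<bar> \<le> 1"
  shows "((\<lambda>t. weight a x t) has_real_derivative - weight (a - 1) x t) (at t)"
proof (cases "x\<^sup>2 = 1")
  case False
  then show ?thesis
    unfolding weight_minus_one[OF assms] unfolding weight_def
    by (auto intro!: derivative_eq_intros simp: mult_ac)
qed simp

lemma has_real_derivative_weight:
  assumes "\<bar>x\<bar> < 1"
  shows "((\<lambda>x. weight a x t) has_real_derivative
           - 2 * a * x * weight (a - 1) x t - 2 * t * x * weight (a - 2) x t) (at x)"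
proof -
  have x: "x\<^sup>2 < 1" using assms abs_square_less_1 by blast
  have "weight (a - 2) x t = weight (a - 1) x t / (1 - x\<^sup>2)"
    using weight_minus_one[of x "a - 1" t] assms by simp
  moreover have "(1 - x\<^sup>2) powr (a - 1) = (1 - x\<^sup>2) powr a / (1 - x\<^sup>2)"
    using x by (simp add: powr_diff)
  moreover have "((\<lambda>x. weight a x t) has_real_derivative
     (a * (1 - x\<^sup>2) powr (a - 1) * (- 2 * x)) * exp (- t / (1 - x\<^sup>2))
     + (1 - x\<^sup>2) powr a * (exp (- t / (1 - x\<^sup>2)) * (- t * (2 * x) / (1 - x\<^sup>2)\<^sup>2))) (at x)"
    unfolding weight_def using x
    by (auto intro!: derivative_eq_intros has_real_derivative_powr' simp: power2_eq_square mult_ac)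
  ultimately show ?thesis
    using assms by (simp add: weight_minus_one weight_def power2_eq_square mult_ac algebra_simps)
qed

section \<open>Integrals of polynomials against the weight\<close>

definition X :: "real poly" where "X = [:0, 1:]"

lemma poly_X [simp]: "poly X x = x"
  by (simp add: X_def)

text \<open>A factor \<open>1 / (1 - x\<^sup>2)\<^sup>j\<close> is absorbed into the exponent: \<open>wint (\<alpha> - j) t f\<close> is its integral
  with \<open>f\<close> against the weight with exponent \<open>\<alpha>\<close>.\<close>

definition wint :: "real \<Rightarrow> real \<Rightarrow> real poly \<Rightarrow> real" where
  "wint a t f = integral {-1..1} (\<lambda>x. poly f x * weight a x t)"

lemma continuous_on_poly_weight:
  "t > 0 \<Longrightarrow> continuous_on {-1..1} (\<lambda>x. poly f x * weight a x t)"
  by (intro continuous_intros continuous_on_weight)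

lemma integrable_poly_weight:
  "t > 0 \<Longrightarrow> (\<lambda>x. poly f x * weight a x t) integrable_on {-1..1}"
  by (intro integrable_continuous_real continuous_on_poly_weight)

lemma wint_0 [simp]: "wint a t 0 = 0"
  by (simp add: wint_def)

lemma wint_smult [simp]: "wint a t (smult c f) = c * wint a t f"
  by (simp add: wint_def mult.assoc)

lemma wint_minus [simp]: "wint a t (- f) = - wint a t f"
  using wint_smult[of a t "-1" f] by simp

lemma wint_add: "t > 0 \<Longrightarrow> wint a t (f + g) = wint a t f + wint a t g"
  unfolding wint_def by (simp add: algebra_simps integral_add integrable_poly_weight)

lemma wint_diff: "t > 0 \<Longrightarrow> wint a t (f - g) = wint a t f - wint a t g"
  using wint_add[of t a f "- g"] by simp

lemma wint_sum: "t > 0 \<Longrightarrow> wint a t (\<Sum>i\<in>I. f i) = (\<Sum>i\<in>I. wint a t (f i))"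
  by (induction I rule: infinite_finite_induct) (auto simp: wint_add)

text \<open>From \<open>x^2 = 1 - (1 - x^2)\<close>. This connects the integrals for the exponents
  \<open>\<alpha>\<close>, \<open>\<alpha> - 1\<close> and \<open>\<alpha> - 2\<close>.\<close>

lemma wint_X_X:
  assumes "t > 0"
  shows "wint a t (X * (X * f)) = wint a t f - wint (a + 1) t f"
proof -
  have "wint (a + 1) t f = wint a t (f - X * (X * f))"
    unfolding wint_def
    by (intro integral_cong) (auto simp: weight_add_one power2_eq_square, simp add: algebra_simps)
  then show ?thesis by (simp add: wint_diff assms)
qed

lemma wint_odd:
  assumes "\<And>x. poly f (- x) = - poly f x"
  shows "wint a t f = 0"
proof -
  have "wint a t f = integral {-1..1} (\<lambda>x. poly f (- x) * weight a (- x) t)"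
    unfolding wint_def
    using Henstock_Kurzweil_Integration.integral_reflect_real[of 1 "-1" "\<lambda>x. poly f x * weight a x t"] by simp
  also have "\<dots> = - wint a t f"
    unfolding wint_def by (simp add: assms)
  finally show ?thesis by simp
qed

text \<open>A zero integral would force \<open>f\<close> to vanish on the open interval, where the
  weight is positive, but a nonzero polynomial has finitely many roots.\<close>

lemma wint_square_pos:
  assumes "t > 0" "f \<noteq> 0"
  shows "wint a t (f * f) > 0"
proof -
  have cont: "continuous_on {-1..1} (\<lambda>x. poly (f * f) x * weight a x t)"
    using assms by (intro continuous_on_poly_weight)
  have nonneg: "poly (f * f) x * weight a x t \<ge> 0" for x
    by (simp add: weight_nonneg)
  have "wint a t (f * f) \<noteq> 0"
  proof
    assume "wint a t (f * f) = 0"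
    then have "\<forall>x\<in>{-1..1}. poly (f * f) x * weight a x t = 0"
      using integral_eq_0_iff[OF cont] nonneg by (auto simp: wint_def)
    then have "poly f x = 0" if "x \<in> {-1<..<1}" for x
      using weight_pos[of x a t] that by (force simp: abs_less_iff)
    then have "{-1<..<1} \<subseteq> {x. poly f x = 0}" by blast
    moreover have "infinite {-1<..<1::real}" by (simp add: infinite_Ioo)
    ultimately show False using poly_roots_finite[OF \<open>f \<noteq> 0\<close>] finite_subset by blast
  qed
  moreover have "wint a t (f * f) \<ge> 0"
    unfolding wint_def using nonneg integrable_poly_weight[OF \<open>t > 0\<close>, of "f * f" a]
    by (intro integral_nonneg) auto
  ultimately show ?thesis by simp
qed

text \<open>No boundary terms, since the weight vanishes at \<open>1\<close> and \<open>-1\<close>.\<close>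

lemma wint_pderiv:
  assumes "t > 0"
  shows "wint a t (pderiv f) = 2 * a * wint (a - 1) t (X * f) + 2 * t * wint (a - 2) t (X * f)"
proof -
  let ?g = "\<lambda>x. poly (pderiv f) x * weight a x t
     - 2 * a * (poly (X * f) x * weight (a - 1) x t)
     - 2 * t * (poly (X * f) x * weight (a - 2) x t)"
  have "(?g has_integral poly f 1 * weight a 1 t - poly f (-1) * weight a (-1) t) {-1..1}"
  proof (rule fundamental_theorem_of_calculus_interior)
    fix x :: real assume "x \<in> {-1<..<1}"
    then have "\<bar>x\<bar> < 1" by auto
    then show "((\<lambda>x. poly f x * weight a x t) has_vector_derivative ?g x) (at x)"
      unfolding has_real_derivative_iff_has_vector_derivative[symmetric]
      by (auto intro!: derivative_eq_intros has_real_derivative_weight simp: algebra_simps)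
  qed (use assms in \<open>auto intro: continuous_on_poly_weight\<close>)
  then have "integral {-1..1} ?g = 0" by (simp add: integral_unique)
  moreover have "integral {-1..1} ?g = wint a t (pderiv f)
     - 2 * a * wint (a - 1) t (X * f) - 2 * t * wint (a - 2) t (X * f)"
    unfolding wint_def
    unfolding integral_mult_right[symmetric]
    by (simp only: integral_diff integrable_diff integrable_poly_weight[OF assms]
        integrable_on_mult_right)
  ultimately show ?thesis by simp
qed

lemma has_real_derivative_wint:
  assumes "t > 0"
  shows "((\<lambda>s. wint a s f) has_real_derivative - wint (a - 1) t f) (at t)"
proof -
  have "((\<lambda>s. integral (cbox (-1) 1) (\<lambda>x. poly f x * weight a x s)) has_field_derivative
         integral (cbox (-1) 1) (\<lambda>x. - (poly f x * weight (a - 1) x t))) (at t within {0<..})"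
  proof (rule leibniz_rule_field_derivative[where fx = "\<lambda>s x. - (poly f x * weight (a - 1) x s)"])
    fix s x :: real assume "s \<in> {0<..}" "x \<in> cbox (-1) 1"
    then show "((\<lambda>s. poly f x * weight a x s) has_real_derivative - (poly f x * weight (a - 1) x s))
                 (at s within {0<..})"
      by (auto intro!: derivative_eq_intros DERIV_subset[OF has_real_derivative_weight_param])
  next
    have "continuous_on ({0<..} \<times> {-1..1}) (\<lambda>z. - (poly f (snd z) * (\<lambda>(t, x). weight (a - 1) x t) z))"
      by (intro continuous_intros continuous_on_weight_prod)
    then show "continuous_on ({0<..} \<times> cbox (-1) 1) (\<lambda>(s, x). - (poly f x * weight (a - 1) x s))"
      by (simp add: case_prod_beta)
  qed (use assms integrable_poly_weight in \<open>auto simp: convex_real_interval\<close>)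
  then show ?thesis
    using assms by (simp add: wint_def at_within_open[of t "{0<..}"])
qed

lemma coeff_X_mult: "coeff (X * f) i = (if i = 0 then 0 else coeff f (i - 1))"
  by (cases i) (auto simp: X_def)

lemma coeff_X_mult_Suc [simp]: "coeff (X * f) (Suc i) = coeff f i"
  by (simp add: coeff_X_mult)

lemma poly_eqI_eval: "(\<And>x. poly f x = poly g x) \<Longrightarrow> f = (g :: real poly)"
  by (simp add: poly_eq_poly_eq_iff[symmetric] ext)

section \<open>Degree bounds and parity\<close>

text \<open>Degree strictly below \<open>n\<close>, phrased by coefficients so that
  \<open>deg_below 0\<close> singles out the zero polynomial.\<close>

definition deg_below :: "nat \<Rightarrow> real poly \<Rightarrow> bool" where
  "deg_below n f \<longleftrightarrow> (\<forall>i\<ge>n. coeff f i = 0)"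

lemma deg_belowD: "deg_below n f \<Longrightarrow> i \<ge> n \<Longrightarrow> coeff f i = 0"
  by (simp add: deg_below_def)

lemma deg_below_0 [simp]: "deg_below n 0"
  by (simp add: deg_below_def)

lemma deg_below_0_iff [simp]: "deg_below 0 f \<longleftrightarrow> f = 0"
  by (auto simp: deg_below_def poly_eq_iff)

lemma deg_below_mono: "deg_below m f \<Longrightarrow> m \<le> n \<Longrightarrow> deg_below n f"
  by (auto simp: deg_below_def)

lemma deg_below_add: "deg_below n f \<Longrightarrow> deg_below n g \<Longrightarrow> deg_below n (f + g)"
  by (simp add: deg_below_def)

lemma deg_below_diff: "deg_below n f \<Longrightarrow> deg_below n g \<Longrightarrow> deg_below n (f - g)"
  by (simp add: deg_below_def)

lemma deg_below_smult: "deg_below n f \<Longrightarrow> deg_below n (smult c f)"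
  by (simp add: deg_below_def)

lemma deg_below_X: "deg_below n f \<Longrightarrow> deg_below (Suc n) (X * f)"
  by (auto simp: deg_below_def coeff_X_mult)

lemma deg_below_pderiv: "deg_below (Suc n) f \<Longrightarrow> deg_below n (pderiv f)"
  by (auto simp: deg_below_def coeff_pderiv)

lemma deg_below_degree: "degree f < n \<Longrightarrow> deg_below n f"
  by (auto simp: deg_below_def coeff_eq_0)

lemma deg_below_SucI: "deg_below (Suc n) f \<Longrightarrow> coeff f n = 0 \<Longrightarrow> deg_below n f"
  by (auto simp: deg_below_def) (metis le_neq_implies_less less_eq_Suc_le)

lemmas deg_below_intros = deg_below_add deg_below_diff deg_below_smult deg_below_X

definition has_parity :: "nat \<Rightarrow> real poly \<Rightarrow> bool" where
  "has_parity n f \<longleftrightarrow> (\<forall>x. poly f (- x) = (-1) ^ n * poly f x)"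

lemma has_parity_add: "has_parity n f \<Longrightarrow> has_parity n g \<Longrightarrow> has_parity n (f + g)"
  by (simp add: has_parity_def algebra_simps)

lemma has_parity_diff: "has_parity n f \<Longrightarrow> has_parity n g \<Longrightarrow> has_parity n (f - g)"
  by (simp add: has_parity_def algebra_simps)

lemma has_parity_smult: "has_parity n f \<Longrightarrow> has_parity n (smult c f)"
  by (simp add: has_parity_def algebra_simps)

lemma has_parity_X: "has_parity n f \<Longrightarrow> has_parity (Suc n) (X * f)"
  by (simp add: has_parity_def algebra_simps)

lemma has_parity_Suc_Suc [simp]: "has_parity (Suc (Suc n)) f \<longleftrightarrow> has_parity n f"
  by (simp add: has_parity_def)

lemma has_parity_mult: "has_parity m f \<Longrightarrow> has_parity n g \<Longrightarrow> has_parity (m + n) (f * g)"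
  by (simp add: has_parity_def power_add algebra_simps)

lemmas has_parity_intros = has_parity_add has_parity_diff has_parity_smult

lemma wint_has_parity_odd: "has_parity n f \<Longrightarrow> odd n \<Longrightarrow> wint a t f = 0"
  by (rule wint_odd) (simp add: has_parity_def)

lemma wint_mult_has_parity:
  "has_parity m f \<Longrightarrow> has_parity n g \<Longrightarrow> odd (m + n) \<Longrightarrow> wint a t (f * g) = 0"
  by (blast intro: wint_has_parity_odd has_parity_mult)

lemma has_parity_coeff:
  assumes "has_parity n f" "odd (n + i)"
  shows "coeff f i = 0"
proof -
  have "pcompose f [:0, -1:] = smult ((-1) ^ n) f"
    using assms(1) by (intro poly_eqI_eval) (simp add: poly_pcompose has_parity_def)
  then have "coeff (pcompose f [:0, -1:]) i = coeff (smult ((-1) ^ n) f) i" by simp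
  then show ?thesis using assms(2) by (auto simp: coeff_pcompose_linear)
qed

text \<open>The two roots give the factor \<open>1 - x^2\<close>; its product with \<open>g\<close>
  is written in the shape to which \<open>wint_X_X\<close> applies.\<close>

lemma vanishing_at_plus_minus_one:
  assumes "deg_below (n + 2) f" "poly f 1 = 0" "poly f (-1) = (0 :: real)"
  obtains g where "f = g - X * (X * g)" "deg_below n g"
proof (cases "f = 0")
  case True
  then show ?thesis using that[of 0] by simp
next
  case False
  obtain g1 where g1: "f = [:-1, 1:] * g1"
    using assms(2) poly_eq_0_iff_dvd[of f 1] by (auto simp: dvd_def)
  then have "poly g1 (-1) = 0" using assms(3) by simp
  then obtain g where g: "g1 = [:1, 1:] * g"
    using poly_eq_0_iff_dvd[of g1 "-1"] by (auto simp: dvd_def)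
  \<comment> \<open>The roots produce \<open>x^2 - 1\<close>, so the cofactor changes sign.\<close>
  have f: "f = (- g) - X * (X * (- g))"
    unfolding g1 g by (rule poly_eqI_eval) (simp add: algebra_simps)
  have "g \<noteq> 0" using False g1 g by auto
  then have "degree f = degree g + 2"
    unfolding g1 g by (simp add: degree_mult_eq del: mult_pCons_left)
  moreover have "degree f < n + 2"
    using deg_belowD[OF assms(1), of "degree f"] False by force
  ultimately show ?thesis using f that[of "- g"] deg_below_degree[of "- g" n] by simp
qed

section \<open>The orthogonal polynomials for a fixed parameter\<close>

locale monic_orthogonal_polys =
  fixes \<alpha> t :: real and p :: "nat \<Rightarrow> real poly" and h :: "nat \<Rightarrow> real"
  assumes t_pos: "t > 0" and orthogonal: "monic_orthogonal \<alpha> t p h"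
begin

lemma degree_p [simp]: "degree (p n) = n"
  using orthogonal unfolding monic_orthogonal_def by blast

lemma coeff_p_self [simp]: "coeff (p n) n = 1"
  using orthogonal degree_p[of n] unfolding monic_orthogonal_def by metis

lemma deg_below_p: "n < m \<Longrightarrow> deg_below m (p n)"
  by (simp add: deg_below_degree)

lemma p_nonzero [simp]: "p n \<noteq> 0"
proof
  assume "p n = 0"
  then show False using coeff_p_self[of n] by (simp del: coeff_p_self)
qed

lemma wint_p_p: "wint \<alpha> t (p m * p n) = (if m = n then h n else 0)"
  using orthogonal by (simp add: monic_orthogonal_def wint_def)

lemma h_pos: "h n > 0"
  using wint_square_pos[OF t_pos p_nonzero[of n], of \<alpha>] by (simp add: wint_p_p)

lemma h_nonzero [simp]: "h n \<noteq> 0"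
  using h_pos[of n] by simp

text \<open>Induction on the degree bound: subtracting a multiple of the monic \<open>p n\<close>
  removes the top coefficient of \<open>g\<close>.\<close>

lemma wint_low_eq_0:
  assumes "\<And>j. j < n \<Longrightarrow> wint \<alpha> t (f * p j) = 0" "deg_below n g"
  shows "wint \<alpha> t (f * g) = 0"
  using assms
proof (induction n arbitrary: g)
  case (Suc n)
  let ?g = "g - smult (coeff g n) (p n)"
  have "deg_below n ?g"
    using Suc.prems(2) by - (rule deg_below_SucI, intro deg_below_intros deg_below_p, auto)
  then have "wint \<alpha> t (f * ?g) = 0"
    by (rule Suc.IH[rotated]) (rule Suc.prems(1), simp)
  then show ?case
    using Suc.prems(1)[of n] by (simp add: right_diff_distrib wint_diff t_pos)
qed simp

text \<open>Such an \<open>f\<close> is orthogonal to itself, which positivity excludes unless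
  \<open>f = 0\<close>.\<close>

lemma eq_0_if_orthogonal:
  assumes "deg_below n f" "\<And>j. j < n \<Longrightarrow> wint \<alpha> t (f * p j) = 0"
  shows "f = 0"
proof -
  have "wint \<alpha> t (f * f) = 0" by (rule wint_low_eq_0[OF assms(2,1)])
  then show ?thesis using wint_square_pos[OF t_pos, of f \<alpha>] by fastforce
qed

lemma wint_p_low: "deg_below n g \<Longrightarrow> wint \<alpha> t (p n * g) = 0"
  by (rule wint_low_eq_0[of n]) (auto simp: wint_p_p)

lemma wint_p_lead:
  assumes "deg_below (Suc n) g"
  shows "wint \<alpha> t (p n * g) = coeff g n * h n"
proof -
  have "deg_below n (g - smult (coeff g n) (p n))"
    using assms by - (rule deg_below_SucI, intro deg_below_intros deg_below_p, auto)
  from wint_p_low[OF this] show ?thesis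
    by (simp add: algebra_simps wint_diff t_pos wint_p_p)
qed

text \<open>The weight is even, so the reflected polynomial with sign \<open>(-1) ^ n\<close> is
  again monic and orthogonal; uniqueness identifies it with \<open>p n\<close>.\<close>

lemma has_parity_p [simp]: "has_parity n (p n)"
proof -
  define refl where "refl f = pcompose f [:0, -1:]" for f :: "real poly"
  let ?f = "p n - smult ((-1) ^ n) (refl (p n))"
  have coeff_refl: "coeff (refl f) i = (-1) ^ i * coeff f i" for f i
    by (simp add: refl_def coeff_pcompose_linear)
  have poly_refl: "poly (refl f) x = poly f (- x)" for f x
    by (simp add: refl_def poly_pcompose)
  have "deg_below n ?f"
    using deg_below_p[of n "Suc n"] by - (rule deg_below_SucI, auto simp: deg_below_def coeff_refl simp flip: power_mult_distrib)
  moreover have "wint \<alpha> t (?f * p j) = 0" if "j < n" for j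
  proof -
    have "deg_below n (refl (p j))"
      using deg_below_p[OF that] by (simp add: deg_below_def coeff_refl)
    then have "wint \<alpha> t (p n * refl (p j)) = 0" by (rule wint_p_low)
    \<comment> \<open>Replacing \<open>x\<close> by \<open>-x\<close> swaps the two products, so
      their difference is odd. This moves the reflection from \<open>p n\<close> to
      \<open>p j\<close>.\<close>
    moreover have "has_parity 1 (refl (p n) * p j - p n * refl (p j))"
      by (simp add: has_parity_def poly_refl)
    then have "wint \<alpha> t (refl (p n) * p j - p n * refl (p j)) = 0"
      by (rule wint_has_parity_odd) simp
    ultimately show ?thesis
      using that by (simp add: algebra_simps wint_diff t_pos wint_p_p)
  qed
  ultimately have "?f = 0" by (rule eq_0_if_orthogonal)
  then have "p n = smult ((-1) ^ n) (refl (p n))" by simp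
  then have "poly (p n) (- x) = (-1) ^ n * poly (refl (p n)) (- x)" for x
    by (metis poly_smult)
  then show ?thesis by (simp add: has_parity_def poly_refl)
qed

lemma p_0 [simp]: "p 0 = 1"
proof -
  have "deg_below 0 (p 0 - 1)"
    by (rule deg_below_SucI, intro deg_below_diff deg_below_p) (auto simp: deg_below_def coeff_eq_0)
  then show ?thesis by simp
qed

lemma p_1: "p (Suc 0) = X"
proof -
  have "deg_below (Suc 0) (p (Suc 0) - X)"
    by (rule deg_below_SucI, intro deg_below_diff deg_below_p) (auto simp: deg_below_def X_def coeff_pCons split: nat.split)
  moreover have "coeff (p (Suc 0) - X) 0 = 0"
    using has_parity_coeff[OF has_parity_p, of "Suc 0" 0] by (simp add: X_def)
  ultimately show ?thesis using deg_below_SucI[of 0 "p (Suc 0) - X"] by simp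
qed

lemma wint_X_p_p_Suc: "wint \<alpha> t (X * (p (Suc m) * p m)) = h (Suc m)"
  using wint_p_lead[of "Suc m" "X * p m"] deg_below_X[OF deg_below_p[of m "Suc m"]]
  by (simp add: mult_ac)

text \<open>By the three-term recurrence \<open>e n\<close> is \<open>\<beta> p (n - 1)\<close> with \<open>\<beta> = h n / h (n - 1)\<close>; as \<open>e 0 = 0\<close>, stating
  facts through \<open>e\<close> covers \<open>n = 0\<close> as well.\<close>

definition e :: "nat \<Rightarrow> real poly" where
  "e n = X * p n - p (Suc n)"

lemma e_0 [simp]: "e 0 = 0"
  by (simp add: e_def p_1)

text \<open>Against \<open>p j\<close>, parity disposes of \<open>j = Suc m\<close>,
  \<open>wint_X_p_p_Suc\<close> gives the coefficient for \<open>j = m\<close>, and for smaller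
  \<open>j\<close> the degree of \<open>X * p j\<close> is too low.\<close>

lemma e_Suc: "e (Suc m) = smult (h (Suc m) / h m) (p m)"
proof -
  let ?\<beta> = "h (Suc m) / h m"
  let ?f = "e (Suc m) - smult ?\<beta> (p m)"
  have "deg_below (Suc (Suc m)) ?f"
  proof (rule deg_below_SucI)
    show "deg_below (Suc (Suc (Suc m))) ?f"
      unfolding e_def by (intro deg_below_intros deg_below_p) auto
    show "coeff ?f (Suc (Suc m)) = 0"
      by (simp add: e_def coeff_eq_0)
  qed
  moreover have "wint \<alpha> t (?f * p j) = 0" if "j < Suc (Suc m)" for j
  proof -
    have expand: "wint \<alpha> t (?f * p j) =
        wint \<alpha> t (p (Suc m) * (X * p j)) - (if j = m then h (Suc m) else 0)"
      using that by (simp add: e_def algebra_simps wint_diff wint_add t_pos wint_p_p)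
    consider "j = Suc m" | "j = m" | "j < m" using \<open>j < Suc (Suc m)\<close> by linarith
    then show ?thesis
    proof cases
      case 1
      have "wint \<alpha> t (p (Suc m) * (X * p (Suc m))) = 0"
        by (rule wint_mult_has_parity[where n = "Suc (Suc m)" and m = "Suc m"])
           (auto intro: has_parity_X simp del: has_parity_Suc_Suc)
      then show ?thesis using expand 1 by simp
    next
      case 2
      then show ?thesis using expand wint_X_p_p_Suc[of m] by (simp add: mult_ac)
    next
      case 3
      then have "deg_below (Suc m) (X * p j)" by (intro deg_below_X deg_below_p) simp
      then show ?thesis using expand 3 wint_p_low by simp
    qed
  qed
  ultimately have "?f = 0" by (rule eq_0_if_orthogonal)
  then show ?thesis by simp
qed

lemma p_Suc_Suc: "p (Suc (Suc m)) = X * p (Suc m) - smult (h (Suc m) / h m) (p m)"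
  using e_Suc[of m] by (simp add: e_def algebra_simps)

text \<open>Parity supplies the second root \<open>-1\<close>, so \<open>1 - x^2\<close> divides
  \<open>f\<close> and cancels the singular factor. The quotient has degree at most
  \<open>n\<close>, and \<open>p n\<close> sees only its coefficient at \<open>n\<close>.\<close>

lemma wint_shift_vanishing:
  assumes "deg_below (n + 3) f" "has_parity n f" "poly f 1 = 0"
  shows "wint (\<alpha> - 1) t (p n * f) = - coeff f (n + 2) * h n"
proof -
  have "poly f (-1) = 0" using assms(2,3) by (simp add: has_parity_def)
  then obtain g where g: "f = g - X * (X * g)" "deg_below (Suc n) g"
    using vanishing_at_plus_minus_one[of "Suc n" f] assms by (auto simp: numeral_3_eq_3)
  have "wint (\<alpha> - 1) t (p n * f) = wint (\<alpha> - 1) t ((p n * g) - X * (X * (p n * g)))"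
    by (simp add: g(1) algebra_simps)
  also have "\<dots> = wint \<alpha> t (p n * g)"
    by (simp add: wint_diff t_pos wint_X_X)
  also have "\<dots> = coeff g n * h n" by (rule wint_p_lead[OF g(2)])
  also have "coeff g n = - coeff f (n + 2)"
    using deg_belowD[OF g(2), of "n + 2"] by (simp add: g(1))
  finally show ?thesis .
qed

text \<open>The combination of \<open>f\<close> and \<open>g\<close> vanishing at 1 has no
  coefficient at \<open>n + 2\<close>, so its integral is 0. Thus the integral against
  \<open>p n\<close> is a multiple of evaluation at 1.\<close>

lemma wint_shift_proportional:
  assumes "deg_below (n + 2) f" "has_parity n f" "deg_below (n + 2) g" "has_parity n g"
  shows "wint (\<alpha> - 1) t (p n * f) * poly g 1 = wint (\<alpha> - 1) t (p n * g) * poly f 1"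
proof -
  let ?f = "smult (poly g 1) f - smult (poly f 1) g"
  have "deg_below (n + 2) ?f" using assms by (intro deg_below_intros)
  then have "deg_below (n + 3) ?f" "coeff ?f (n + 2) = 0"
    by (rule deg_below_mono) (use deg_belowD[OF \<open>deg_below (n + 2) ?f\<close>] in auto)
  moreover have "has_parity n ?f" using assms by (intro has_parity_intros)
  ultimately have "wint (\<alpha> - 1) t (p n * ?f) = 0"
    using wint_shift_vanishing[of n ?f] by simp
  then show ?thesis by (simp add: algebra_simps wint_diff t_pos)
qed

text \<open>A root at 1 would make the integral of the square of \<open>p n\<close> with exponent
  \<open>\<alpha> - 1\<close> vanish.\<close>

lemma p_at_1_nonzero: "poly (p n) 1 \<noteq> 0"
proof
  assume "poly (p n) 1 = 0"
  then have "wint (\<alpha> - 1) t (p n * p n) = 0"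
    using wint_shift_vanishing[of n "p n"] by (simp add: deg_below_p coeff_eq_0)
  then show False using wint_square_pos[OF t_pos p_nonzero, of "\<alpha> - 1" n] by simp
qed

section \<open>The auxiliary quantities at a fixed parameter\<close>

definition R :: "nat \<Rightarrow> real" where
  "R n = 2 * t / h n * wint (\<alpha> - 1) t (p n * p n)"

text \<open>\<open>R\<close> and \<open>r\<close> are the values of \<open>R_aux\<close> and
  \<open>r_aux\<close> with the singular factor absorbed into the exponent; see
  \<open>R_aux_eq_R\<close> and \<open>r_aux_eq_r\<close>.\<close>

definition r :: "nat \<Rightarrow> real" where
  "r n = (if n = 0 then 0 else 2 * t / h (n - 1) * wint (\<alpha> - 1) t (X * (p n * p (n - 1))))"

lemma R_pos: "R n > 0"
  using t_pos h_pos wint_square_pos[OF t_pos p_nonzero] by (simp add: R_def)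

lemma wint_p_p_shift: "2 * t * wint (\<alpha> - 1) t (p n * p n) = h n * R n"
  by (simp add: R_def)

lemma wint_X_p_p_shift: "2 * t * wint (\<alpha> - 1) t (X * (p (Suc m) * p m)) = h m * r (Suc m)"
  by (simp add: r_def)

lemma wint_X_p_e_shift: "2 * t * wint (\<alpha> - 1) t (X * (p n * e n)) = h n * r n"
  by (cases n) (simp_all add: r_def e_Suc)

text \<open>Integration by parts for \<open>X * (p n * p n)\<close>; \<open>wint_X_X\<close> then
  removes the factor \<open>X * X\<close> under both singular integrals.\<close>

lemma wint_p_p_shift2:
  "2 * t * wint (\<alpha> - 2) t (p n * p n) = h n * (2 * real n + 1 + 2 * \<alpha> + R n - \<alpha> * R n / t)"
proof -
  let ?p = "p n"
  have "deg_below (Suc n) (X * pderiv ?p)" by (intro deg_below_X deg_below_pderiv deg_below_p) simp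
  then have 1: "wint \<alpha> t (X * (?p * pderiv ?p)) = real n * h n"
    by (subst mult.left_commute, subst wint_p_lead) (auto simp: coeff_X_mult coeff_pderiv)
  have "pderiv (X * (?p * ?p)) = ?p * ?p + smult 2 (X * (?p * pderiv ?p))"
    by (rule poly_eqI_eval) (simp add: pderiv_mult X_def pderiv_pCons algebra_simps)
  then have "wint \<alpha> t (pderiv (X * (?p * ?p))) = (2 * real n + 1) * h n"
    by (simp add: wint_add t_pos wint_p_p 1 algebra_simps)
  moreover have "wint \<alpha> t (pderiv (X * (?p * ?p))) =
      2 * \<alpha> * wint (\<alpha> - 1) t (X * (X * (?p * ?p))) + 2 * t * wint (\<alpha> - 2) t (X * (X * (?p * ?p)))"
    by (subst wint_pderiv[OF t_pos]) simp
  moreover have "wint (\<alpha> - 2) t (X * (X * (?p * ?p))) = wint (\<alpha> - 2) t (?p * ?p) - wint (\<alpha> - 1) t (?p * ?p)"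
    using wint_X_X[OF t_pos, of "\<alpha> - 2" "?p * ?p"] by simp
  moreover have "wint (\<alpha> - 1) t (X * (X * (?p * ?p))) = wint (\<alpha> - 1) t (?p * ?p) - h n"
    using wint_X_X[OF t_pos, of "\<alpha> - 1" "?p * ?p"] by (simp add: wint_p_p)
  ultimately have "2 * t * wint (\<alpha> - 2) t (?p * ?p) =
      (2 * real n + 1 + 2 * \<alpha>) * h n + 2 * t * wint (\<alpha> - 1) t (?p * ?p) - 2 * \<alpha> * wint (\<alpha> - 1) t (?p * ?p)"
    by (simp add: algebra_simps)
  moreover have "2 * \<alpha> * wint (\<alpha> - 1) t (?p * ?p) = \<alpha> * (h n * R n) / t"
    using wint_p_p_shift[of n, symmetric] t_pos by simp
  ultimately show ?thesis
    unfolding wint_p_p_shift by (simp add: algebra_simps)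
qed

text \<open>Integration by parts for \<open>p (Suc m) * p m\<close>. Of the two terms of the
  derivative only \<open>p m\<close> times \<open>pderiv (p (Suc m))\<close> contributes, through
  its leading coefficient.\<close>

lemma wint_X_p_p_shift2:
  "2 * t * wint (\<alpha> - 2) t (X * (p (Suc m) * p m)) = h m * (real (Suc m) - \<alpha> * r (Suc m) / t)"
proof -
  let ?p = "p (Suc m)" and ?q = "p m"
  have 1: "wint \<alpha> t (?q * pderiv ?p) = real (Suc m) * h m"
    using deg_below_pderiv[OF deg_below_p, of "Suc m" "Suc m"]
    by (subst wint_p_lead) (auto simp: coeff_pderiv)
  have "deg_below (Suc m) (pderiv ?q)" by (intro deg_below_pderiv deg_below_p) simp
  then have 2: "wint \<alpha> t (?p * pderiv ?q) = 0" by (rule wint_p_low)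
  have "wint \<alpha> t (pderiv (?p * ?q)) = real (Suc m) * h m"
    using 1 2 by (simp add: pderiv_mult wint_add t_pos mult.commute)
  moreover have "wint \<alpha> t (pderiv (?p * ?q)) =
      2 * \<alpha> * wint (\<alpha> - 1) t (X * (?p * ?q)) + 2 * t * wint (\<alpha> - 2) t (X * (?p * ?q))"
    by (subst wint_pderiv[OF t_pos]) simp
  moreover have "2 * \<alpha> * wint (\<alpha> - 1) t (X * (?p * ?q)) = \<alpha> * (h m * r (Suc m)) / t"
    using wint_X_p_p_shift[of m, symmetric] t_pos by simp
  ultimately show ?thesis
    by (simp add: algebra_simps)
qed

lemma wint_X_p_e_shift2:
  "2 * t * wint (\<alpha> - 2) t (X * (p n * e n)) = h n * (real n - \<alpha> * r n / t)"
proof (cases n)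
  case (Suc m)
  then show ?thesis
    using arg_cong[OF wint_X_p_p_shift2[of m], of "\<lambda>z. h n / h m * z"]
    by (simp add: e_Suc mult_ac)
qed (simp add: r_def)

text \<open>\<open>wint_shift_proportional\<close> compares \<open>p n\<close> with
  \<open>X * e n\<close>.\<close>

lemma r_p_at_1: "r n * poly (p n) 1 = R n * poly (e n) 1"
proof (cases n)
  case (Suc m)
  have "deg_below (n + 2) (p n)" "deg_below (n + 2) (X * e n)"
    by (auto simp: Suc e_Suc intro!: deg_below_intros deg_below_p)
  moreover have "has_parity (Suc m + 1) (e n)"
    by (simp add: Suc e_Suc has_parity_smult)
  then have "has_parity n (X * e n)" using has_parity_X by (fastforce simp: Suc)
  ultimately have "wint (\<alpha> - 1) t (p n * p n) * poly (X * e n) 1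
      = wint (\<alpha> - 1) t (p n * (X * e n)) * poly (p n) 1"
    by (intro wint_shift_proportional) auto
  then have "2 * t * wint (\<alpha> - 1) t (p n * p n) * poly (e n) 1
      = 2 * t * wint (\<alpha> - 1) t (X * (p n * e n)) * poly (p n) 1"
    by (simp add: mult_ac)
  then show ?thesis
    by (simp add: wint_p_p_shift wint_X_p_e_shift)
qed (simp add: r_def)

text \<open>The test polynomial \<open>?f\<close> vanishes at 1 but has degree \<open>m + 2\<close>,
  beyond the range of \<open>wint_shift_proportional\<close>; its leading coefficient produces the
  summand \<open>2 * t\<close>.\<close>

lemma r_Suc_p_at_1: "(r (Suc m) + 2 * t) * poly (p m) 1 = R m * poly (p (Suc m)) 1"
proof -
  let ?p = "p (Suc m)" and ?q = "p m"
  let ?f = "smult (poly ?q 1) (X * ?p) - smult (poly ?p 1) ?q"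
  have "deg_below (m + 3) ?f" by (intro deg_below_intros deg_below_p | simp add: numeral_3_eq_3 deg_below_X deg_below_p)+
  moreover have "has_parity m ?f"
    using has_parity_X[OF has_parity_p[of "Suc m"]] by (intro has_parity_intros) auto
  ultimately have "wint (\<alpha> - 1) t (?q * ?f) = - coeff ?f (m + 2) * h m"
    by (rule wint_shift_vanishing) simp
  moreover have "coeff ?f (m + 2) = poly ?q 1"
    by (simp add: coeff_eq_0)
  moreover have "wint (\<alpha> - 1) t (?q * ?f) =
     poly ?q 1 * wint (\<alpha> - 1) t (X * (?p * ?q)) - poly ?p 1 * wint (\<alpha> - 1) t (?q * ?q)"
    by (simp add: algebra_simps wint_diff t_pos)
  ultimately have "poly ?q 1 * (2 * t * wint (\<alpha> - 1) t (X * (?p * ?q)))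
      - poly ?p 1 * (2 * t * wint (\<alpha> - 1) t (?q * ?q)) = - 2 * t * poly ?q 1 * h m"
    by algebra
  then have "h m * ((r (Suc m) + 2 * t) * poly ?q 1) = h m * (R m * poly ?p 1)"
    unfolding wint_p_p_shift wint_X_p_p_shift by (simp add: algebra_simps)
  then show ?thesis by simp
qed

text \<open>Multiply the definition of \<open>e n\<close> by \<open>X * p n\<close> and integrate
  with exponent \<open>\<alpha> - 1\<close>. Solved for \<open>r n\<close>, it later eliminates
  \<open>r m\<close> in favour of \<open>r (Suc m)\<close>.\<close>

lemma r_add_r_Suc: "r n = R n - 2 * t - r (Suc n)"
proof -
  have "wint (\<alpha> - 1) t (X * (p n * e n)) =
      wint (\<alpha> - 1) t (X * (X * (p n * p n))) - wint (\<alpha> - 1) t (X * (p (Suc n) * p n))"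
    by (simp add: e_def algebra_simps wint_diff t_pos)
  moreover have "wint (\<alpha> - 1) t (X * (X * (p n * p n))) = wint (\<alpha> - 1) t (p n * p n) - h n"
    using wint_X_X[OF t_pos, of "\<alpha> - 1" "p n * p n"] by (simp add: wint_p_p)
  ultimately have "2 * t * wint (\<alpha> - 1) t (X * (p n * e n)) =
     2 * t * wint (\<alpha> - 1) t (p n * p n) - 2 * t * h n - 2 * t * wint (\<alpha> - 1) t (X * (p (Suc n) * p n))"
    by algebra
  then have "h n * r n = h n * (R n - 2 * t - r (Suc n))"
    unfolding wint_p_p_shift wint_X_p_p_shift wint_X_p_e_shift by (simp add: algebra_simps)
  then show ?thesis by simp
qed

text \<open>Chain \<open>r_p_at_1\<close> and \<open>r_Suc_p_at_1\<close>, then cancel the value of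
  \<open>p (Suc m)\<close> at 1.\<close>

lemma r_quadratic: "h (Suc m) * R (Suc m) * R m = h m * (r (Suc m) * (r (Suc m) + 2 * t))"
proof -
  have "h m * (r (Suc m) * poly (p (Suc m)) 1) = h (Suc m) * (R (Suc m) * poly (p m) 1)"
    unfolding r_p_at_1 by (simp add: e_Suc)
  then have "h m * r (Suc m) * (r (Suc m) + 2 * t) * poly (p (Suc m)) 1
      = h (Suc m) * R (Suc m) * ((r (Suc m) + 2 * t) * poly (p m) 1)"
    by algebra
  also have "\<dots> = h (Suc m) * R (Suc m) * R m * poly (p (Suc m)) 1"
    unfolding r_Suc_p_at_1 by simp
  finally show ?thesis using p_at_1_nonzero[of "Suc m"] by simp
qed

end

text \<open>In this form parity passes to derivatives taken coefficient by coefficient.\<close>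

lemma has_parity_iff_coeff: "has_parity n f \<longleftrightarrow> (\<forall>i. odd (n + i) \<longrightarrow> coeff f i = 0)"
proof
  assume *: "\<forall>i. odd (n + i) \<longrightarrow> coeff f i = 0"
  have "pcompose f [:0, -1:] = smult ((-1) ^ n) f"
  proof (rule poly_eqI)
    fix i
    show "coeff (pcompose f [:0, -1:]) i = coeff (smult ((-1) ^ n) f) i"
      using * by (cases "even i"; cases "even n") (auto simp: coeff_pcompose_linear)
  qed
  then have "poly (pcompose f [:0, -1:]) x = (-1) ^ n * poly f x" for x by simp
  then show "has_parity n f" by (simp add: has_parity_def poly_pcompose)
qed (blast intro: has_parity_coeff)

section \<open>Dependence on the parameter\<close>

definition coeff_deriv :: "(real \<Rightarrow> real poly) \<Rightarrow> real poly \<Rightarrow> real \<Rightarrow> bool" where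
  "coeff_deriv F F' t \<longleftrightarrow> (\<forall>i. ((\<lambda>s. coeff (F s) i) has_real_derivative coeff F' i) (at t))"

lemma coeff_deriv_const: "coeff_deriv (\<lambda>_. f) 0 t"
  by (simp add: coeff_deriv_def)

lemma coeff_deriv_diff:
  "coeff_deriv F F' t \<Longrightarrow> coeff_deriv G G' t \<Longrightarrow> coeff_deriv (\<lambda>s. F s - G s) (F' - G') t"
  by (auto simp: coeff_deriv_def intro!: derivative_eq_intros)

lemma coeff_deriv_mult:
  assumes "coeff_deriv F F' t" "coeff_deriv G G' t"
  shows "coeff_deriv (\<lambda>s. F s * G s) (F' * G t + F t * G') t"
  unfolding coeff_deriv_def
proof
  fix i
  have "((\<lambda>s. \<Sum>j\<le>i. coeff (F s) j * coeff (G s) (i - j)) has_real_derivative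
      (\<Sum>j\<le>i. coeff (F t) j * coeff G' (i - j) + coeff F' j * coeff (G t) (i - j))) (at t)"
    using assms unfolding coeff_deriv_def by (intro DERIV_sum DERIV_mult') auto
  then show "((\<lambda>s. coeff (F s * G s) i) has_real_derivative coeff (F' * G t + F t * G') i) (at t)"
    by (simp add: coeff_mult sum.distrib add.commute)
qed

lemma coeff_deriv_smult:
  assumes "(c has_real_derivative c') (at t)" "coeff_deriv F F' t"
  shows "coeff_deriv (\<lambda>s. smult (c s) (F s)) (smult c' (F t) + smult (c t) F') t"
  using assms by (auto simp: coeff_deriv_def intro!: derivative_eq_intros)

text \<open>Orthogonality is available for positive parameters, and these form a neighbourhood of
  \<open>t\<close>.\<close>

lemma coeff_deriv_transform:
  assumes "coeff_deriv G G' t" "t > 0" "\<And>s. s > 0 \<Longrightarrow> F s = G s"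
  shows "coeff_deriv F G' t"
  unfolding coeff_deriv_def
proof
  fix i
  show "((\<lambda>s. coeff (F s) i) has_real_derivative coeff G' i) (at t)"
    by (rule has_field_derivative_transform_within_open[where f = "\<lambda>s. coeff (G s) i" and S = "{0<..}"])
       (use assms in \<open>auto simp: coeff_deriv_def\<close>)
qed

lemma coeff_deriv_eq_0:
  assumes "coeff_deriv F F' t" "t > 0" "\<And>s. s > 0 \<Longrightarrow> coeff (F s) i = c"
  shows "coeff F' i = 0"
proof (rule DERIV_unique)
  show "((\<lambda>s. coeff (F s) i) has_real_derivative coeff F' i) (at t)"
    using assms(1) by (simp add: coeff_deriv_def)
  show "((\<lambda>s. coeff (F s) i) has_real_derivative 0) (at t)"
    by (rule has_field_derivative_transform_within_open[where f = "\<lambda>s. c" and S = "{0<..}"])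
       (use assms in auto)
qed

lemma wint_expand:
  assumes "t > 0" "deg_below d f"
  shows "wint a t f = (\<Sum>i<d. coeff f i * wint a t (monom 1 i))"
proof -
  have "f = (\<Sum>i<d. smult (coeff f i) (monom 1 i))"
    using assms(2) by (intro poly_eqI) (auto simp: coeff_sum deg_below_def if_distrib cong: if_cong)
  then have "wint a t f = wint a t (\<Sum>i<d. smult (coeff f i) (monom 1 i))" by simp
  then show ?thesis by (simp add: wint_sum assms(1))
qed

text \<open>The degree bound common to all \<open>s\<close> turns the integral into a fixed finite
  sum of coefficients times moments, to which the product rule applies.\<close>

lemma has_real_derivative_wint_family:
  assumes "coeff_deriv F F' t" "t > 0" "\<And>s. s > 0 \<Longrightarrow> deg_below d (F s)"
  shows "((\<lambda>s. wint a s (F s)) has_real_derivative wint a t F' - wint (a - 1) t (F t)) (at t)"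
proof -
  have "deg_below d F'"
    unfolding deg_below_def using coeff_deriv_eq_0[OF assms(1,2)] assms(3) by (auto simp: deg_below_def)
  let ?g = "\<lambda>s. \<Sum>i<d. coeff (F s) i * wint a s (monom 1 i)"
  have "(?g has_real_derivative
      (\<Sum>i<d. coeff F' i * wint a t (monom 1 i) + - wint (a - 1) t (monom 1 i) * coeff (F t) i)) (at t)"
    using assms(1,2) unfolding coeff_deriv_def
    by (intro DERIV_sum DERIV_mult has_real_derivative_wint) auto
  also have "(\<Sum>i<d. coeff F' i * wint a t (monom 1 i) + - wint (a - 1) t (monom 1 i) * coeff (F t) i)
      = wint a t F' - wint (a - 1) t (F t)"
    using wint_expand[OF assms(2) \<open>deg_below d F'\<close>, of a]
      wint_expand[OF assms(2) assms(3)[OF assms(2)], of "a - 1"]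
    by (simp add: sum.distrib sum_negf sum_subtractf mult.commute)
  finally show ?thesis
    by (rule has_field_derivative_transform_within_open[where S = "{0<..}"])
       (use assms in \<open>auto intro: wint_expand[symmetric]\<close>)
qed

section \<open>Differentiability of the family\<close>

locale monic_orthogonal_family =
  fixes \<alpha> :: real and P :: "nat \<Rightarrow> real \<Rightarrow> real poly" and h :: "nat \<Rightarrow> real \<Rightarrow> real"
  assumes polys: "\<And>s. s > 0 \<Longrightarrow> monic_orthogonal_polys \<alpha> s (\<lambda>k. P k s) (\<lambda>k. h k s)"
begin

lemma deg_below_P: "s > 0 \<Longrightarrow> deg_below (Suc n) (P n s)"
  using monic_orthogonal_polys.deg_below_p[OF polys, of s n "Suc n"] by simp

lemma deg_below_P_mult: "s > 0 \<Longrightarrow> deg_below (m + n + 1) (P m s * P n s)"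
  using degree_mult_le[of "P m s" "P n s"] monic_orthogonal_polys.degree_p[OF polys]
  by (intro deg_below_degree) auto

lemma h_eq: "s > 0 \<Longrightarrow> h n s = wint \<alpha> s (P n s * P n s)"
  using monic_orthogonal_polys.wint_p_p[OF polys, of s n n] by simp

lemma h_nonzero_at: "s > 0 \<Longrightarrow> h n s \<noteq> 0"
  using monic_orthogonal_polys.h_nonzero[OF polys] .

lemma has_real_derivative_h:
  assumes "coeff_deriv (P n) D t" "t > 0"
  shows "(h n has_real_derivative 2 * wint \<alpha> t (D * P n t) - wint (\<alpha> - 1) t (P n t * P n t)) (at t)"
proof -
  have "((\<lambda>s. wint \<alpha> s (P n s * P n s)) has_real_derivative
      wint \<alpha> t (D * P n t + P n t * D) - wint (\<alpha> - 1) t (P n t * P n t)) (at t)"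
    by (rule has_real_derivative_wint_family[OF coeff_deriv_mult[OF assms(1,1)] assms(2) deg_below_P_mult])
  moreover have "wint \<alpha> t (D * P n t + P n t * D) = 2 * wint \<alpha> t (D * P n t)"
    by (simp only: mult.commute[of "P n t" D] wint_add assms)
  ultimately have "((\<lambda>s. wint \<alpha> s (P n s * P n s)) has_real_derivative
      2 * wint \<alpha> t (D * P n t) - wint (\<alpha> - 1) t (P n t * P n t)) (at t)" by simp
  then show ?thesis
    by (rule has_field_derivative_transform_within_open[where S = "{0<..}"])
       (use assms h_eq in auto)
qed

text \<open>The coefficients inherit differentiability from the moments through the recurrence.\<close>

lemma ex_coeff_deriv:
  assumes "t > 0"
  shows "\<exists>D. coeff_deriv (P n) D t"
proof (induction n rule: less_induct)
  case (less n)
  consider "n = 0" | "n = Suc 0" | m where "n = Suc (Suc m)"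
    by (metis not0_implies_Suc)
  then show ?case
  proof cases
    case 1
    show ?thesis
      by (rule exI, rule coeff_deriv_transform[OF coeff_deriv_const assms])
         (simp add: 1 monic_orthogonal_polys.p_0[OF polys])
  next
    case 2
    show ?thesis
      by (rule exI, rule coeff_deriv_transform[OF coeff_deriv_const assms])
         (simp add: 2 monic_orthogonal_polys.p_1[OF polys])
  next
    case 3
    obtain D0 D1 where D: "coeff_deriv (P m) D0 t" "coeff_deriv (P (Suc m)) D1 t"
      using less[of m] less[of "Suc m"] 3 by auto
    have "coeff_deriv (\<lambda>s. X * P (Suc m) s) (0 * P (Suc m) t + X * D1) t"
      by (intro coeff_deriv_mult coeff_deriv_const D)
    \<comment> \<open>The norms are differentiable once the polynomials are, hence so is the
      recurrence coefficient.\<close>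
    moreover obtain c where c: "((\<lambda>s. h (Suc m) s / h m s) has_real_derivative c) (at t)"
      using DERIV_divide[OF has_real_derivative_h[OF D(2) assms] has_real_derivative_h[OF D(1) assms]]
        h_nonzero_at[OF assms] by blast
    ultimately show ?thesis
      using coeff_deriv_transform[OF coeff_deriv_diff[OF _ coeff_deriv_smult[OF c D(1)]] assms]
        monic_orthogonal_polys.p_Suc_Suc[OF polys] unfolding 3 by blast
  qed
qed

end

section \<open>The parameter derivative of the polynomials\<close>

locale monic_orthogonal_family_at = monic_orthogonal_family +
  fixes t :: real
  assumes t_positive: "t > 0"

sublocale monic_orthogonal_family_at \<subseteq> monic_orthogonal_polys \<alpha> t "\<lambda>k. P k t" "\<lambda>k. h k t"
  by (rule polys[OF t_positive])

context monic_orthogonal_family_at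
begin

text \<open>The leading coefficient is constantly 1, so differentiation lowers the degree.\<close>

lemma deg_below_coeff_deriv:
  assumes "coeff_deriv (P n) D t"
  shows "deg_below n D"
  unfolding deg_below_def
proof (intro allI impI)
  fix i assume "n \<le> i"
  then have "coeff (P n s) i = (if i = n then 1 else 0)" if "s > 0" for s
    using monic_orthogonal_polys.coeff_p_self[OF polys[OF that], of n] deg_belowD[OF deg_below_P[OF that], of n i]
    by simp
  then show "coeff D i = 0" by (rule coeff_deriv_eq_0[OF assms t_positive])
qed

lemma has_parity_coeff_deriv:
  assumes "coeff_deriv (P n) D t"
  shows "has_parity n D"
  unfolding has_parity_iff_coeff
proof (intro allI impI)
  fix i assume "odd (n + i)"
  then have "coeff (P n s) i = 0" if "s > 0" for s
    using has_parity_coeff[OF monic_orthogonal_polys.has_parity_p[OF polys[OF that]]] by simp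
  then show "coeff D i = 0" by (rule coeff_deriv_eq_0[OF assms t_positive])
qed

text \<open>Differentiating the relations \<open>wint \<alpha> s (P n s * g) = 0\<close> with respect to \<open>s\<close>.\<close>

lemma wint_coeff_deriv:
  assumes "coeff_deriv (P n) D t" "deg_below n g"
  shows "wint \<alpha> t (D * g) = wint (\<alpha> - 1) t (P n t * g)"
proof -
  have "deg_below (2 * n + 1) (P n s * g)" if "s > 0" for s
  proof (cases "g = 0")
    case False
    then have "degree g < n" using deg_belowD[OF assms(2), of "degree g"] by force
    then show ?thesis
      using degree_mult_le[of "P n s" g] monic_orthogonal_polys.degree_p[OF polys[OF that], of n]
      by (intro deg_below_degree) simp
  qed simp
  from has_real_derivative_wint_family[OF coeff_deriv_mult[OF assms(1) coeff_deriv_const] t_positive this]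
  have "((\<lambda>s. wint \<alpha> s (P n s * g)) has_real_derivative
      wint \<alpha> t (D * g) - wint (\<alpha> - 1) t (P n t * g)) (at t)" by simp
  moreover have "((\<lambda>s. wint \<alpha> s (P n s * g)) has_real_derivative 0) (at t)"
    by (rule has_field_derivative_transform_within_open[where f = "\<lambda>s. 0" and S = "{0<..}"])
       (use t_positive monic_orthogonal_polys.wint_p_low[OF polys assms(2)] in auto)
  ultimately show ?thesis using DERIV_unique by fastforce
qed

lemma wint_coeff_deriv_p:
  assumes "coeff_deriv (P n) D t"
  shows "wint \<alpha> t (D * P n t) = 0"
  using wint_p_low[OF deg_below_coeff_deriv[OF assms]] by (simp add: mult.commute)

text \<open>\<open>D\<close> is orthogonal to \<open>P n t\<close>, so only the derivative of the
  weight contributes.\<close>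

lemma DERIV_h: "(h n has_real_derivative - (h n t * R n / (2 * t))) (at t)"
proof -
  obtain D where D: "coeff_deriv (P n) D t" using ex_coeff_deriv[OF t_positive] by blast
  show ?thesis
    using has_real_derivative_h[OF D t_positive] wint_p_p_shift[of n, symmetric] t_positive
    by (simp add: wint_coeff_deriv_p[OF D])
qed

lemma deg_below_e: "deg_below n (e n)"
  by (cases n) (auto simp: e_Suc intro!: deg_below_smult deg_below_p)

lemma has_parity_e: "has_parity (Suc n) (e n)"
proof (cases n)
  case (Suc m)
  then show ?thesis using has_parity_p[of m] by (simp add: e_Suc has_parity_smult)
qed (simp add: has_parity_def)

text \<open>The difference of both sides is orthogonal to all polynomials of degree at most \<open>n - 2\<close>, so
  by parity it is a multiple of \<open>P n t\<close>; it vanishes at \<open>1\<close>, whereas \<open>P n t\<close> does not.\<close>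

lemma coeff_deriv_ladder:
  assumes D: "coeff_deriv (P n) D t"
  shows "smult (2 * t) (D - X * (X * D)) = smult (R n) (X * e n) - smult (r n) (P n t)"
proof (cases n)
  case 0
  then show ?thesis using deg_below_coeff_deriv[OF D] by (simp add: r_def)
next
  case (Suc m)
  let ?p = "P n t"
  define Z where "Z = smult (2 * t) (D - X * (X * D)) - smult (R n) (X * e n) + smult (r n) ?p"
  note deg_below_D = deg_below_coeff_deriv[OF D] and parity_D = has_parity_coeff_deriv[OF D]
  have parity_Z: "has_parity n Z"
    unfolding Z_def using parity_D has_parity_X[OF has_parity_X[OF parity_D]]
      has_parity_X[OF has_parity_e, of n]
    by (intro has_parity_intros) auto
  have deg_below_Z: "deg_below (n + 2) Z"
    unfolding Z_def using deg_below_X[OF deg_below_X[OF deg_below_D]]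
    by (intro deg_below_intros deg_below_mono[OF deg_below_D] deg_below_mono[OF deg_below_X[OF deg_below_e]] deg_below_p) auto
  have orth: "wint \<alpha> t (Z * g) = 0" if "deg_below m g" for g
  proof -
    \<comment> \<open>The coefficient of \<open>(1 - x^2) g\<close> at \<open>n\<close> is
      \<open>- c\<close>, so adding \<open>c\<close> times \<open>P n t\<close> brings the degree
      below \<open>n\<close>, where \<open>wint_coeff_deriv\<close> applies. Using
      \<open>X * g\<close> covers \<open>m = 0\<close>.\<close>
    define c where "c = coeff (X * g) m"
    have deg_below_g: "deg_below n g" using that Suc by (auto intro: deg_below_mono)
    have "deg_below n (g - X * (X * g) + smult c ?p)"
    proof (rule deg_below_SucI)
      show "deg_below (Suc n) (g - X * (X * g) + smult c ?p)"
        using deg_below_X[OF deg_below_X[OF that]] Suc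
        by (intro deg_below_add deg_below_diff deg_below_smult deg_below_mono[OF deg_below_g] deg_below_p) auto
      show "coeff (g - X * (X * g) + smult c ?p) n = 0"
        using deg_belowD[OF deg_below_g, of n] by (simp add: c_def Suc del: coeff_p_self) (use coeff_p_self[of n] Suc in simp)
    qed
    from wint_coeff_deriv[OF D this]
    have "wint \<alpha> t (D * g) - wint \<alpha> t (D * (X * (X * g))) + c * wint \<alpha> t (D * ?p)
        = wint (\<alpha> - 1) t (?p * g) - wint (\<alpha> - 1) t (?p * (X * (X * g))) + c * wint (\<alpha> - 1) t (?p * ?p)"
      by (simp only: distrib_left right_diff_distrib wint_add wint_diff t_pos mult_smult_right wint_smult)
    moreover have "wint (\<alpha> - 1) t (?p * (X * (X * g))) = wint (\<alpha> - 1) t (?p * g) - wint \<alpha> t (?p * g)"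
      using wint_X_X[OF t_pos, of "\<alpha> - 1" "?p * g"] by (simp add: mult.left_commute[of ?p X])
    moreover have "wint \<alpha> t (?p * g) = 0" by (rule wint_p_low[OF deg_below_g])
    ultimately have "2 * t * (wint \<alpha> t (D * g) - wint \<alpha> t (D * (X * (X * g)))) = c * (h n t * R n)"
      using wint_p_p_shift[of n, symmetric] by (simp add: wint_coeff_deriv_p[OF D])
    moreover have "wint \<alpha> t (P m t * (X * g)) = c * h m t"
      unfolding c_def by (rule wint_p_lead) (use deg_below_X[OF that] in simp)
    then have "wint \<alpha> t (e n * (X * g)) = c * h n t"
      by (simp add: Suc e_Suc)
    moreover have "wint \<alpha> t (?p * g) = 0" by (rule wint_p_low[OF deg_below_g])
    moreover have "wint \<alpha> t (Z * g) = 2 * t * (wint \<alpha> t (D * g) - wint \<alpha> t (D * (X * (X * g))))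
        - R n * wint \<alpha> t (e n * (X * g)) + r n * wint \<alpha> t (?p * g)"
      unfolding Z_def
      by (simp add: algebra_simps wint_add wint_diff t_pos)
    ultimately show ?thesis by simp
  qed
  define c where "c = wint \<alpha> t (Z * ?p) / h n t"
  have "Z - smult c ?p = 0"
  proof (rule eq_0_if_orthogonal)
    show "deg_below (n + 2) (Z - smult c ?p)" using deg_below_Z by (intro deg_below_intros deg_below_p) auto
    fix j assume "j < n + 2"
    \<comment> \<open>The indices \<open>n - 1\<close> and \<open>n + 1\<close> fall under the
      parity case.\<close>
    then consider "j = n" | "odd (n + j)" | "j < m" using Suc
      by (cases "j = n"; cases "j = Suc n"; cases "j = m") auto
    then show "wint \<alpha> t ((Z - smult c ?p) * P j t) = 0"
    proof cases
      case 1
      then show ?thesis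
        by (simp add: left_diff_distrib wint_diff t_pos c_def wint_p_p)
    next
      case 2
      have "has_parity n (Z - smult c ?p)" by (intro has_parity_intros parity_Z has_parity_p)
      with 2 show ?thesis using wint_mult_has_parity[OF _ has_parity_p] by blast
    next
      case 3
      then show ?thesis using Suc
        by (simp add: left_diff_distrib wint_diff t_pos wint_p_p orth deg_below_p)
    qed
  qed
  then have "Z = smult c ?p" by simp
  moreover have "poly Z 1 = 0"
    using r_p_at_1[of n] by (simp add: Z_def)
  ultimately have "Z = 0" using p_at_1_nonzero[of n] by auto
  then show ?thesis by (simp add: Z_def algebra_simps)
qed

text \<open>Lowering the exponent once more pays for a factor \<open>1 - x^2\<close> on
  \<open>D\<close>, which \<open>coeff_deriv_ladder\<close> then replaces.\<close>

lemma wint_coeff_deriv_shift: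
  assumes "coeff_deriv (P n) D t"
  shows "2 * t * wint (\<alpha> - 1) t (D * f) =
    R n * wint (\<alpha> - 2) t (X * (e n * f)) - r n * wint (\<alpha> - 2) t (P n t * f)"
proof -
  have "2 * t * wint (\<alpha> - 1) t (D * f) =
      2 * t * (wint (\<alpha> - 2) t (D * f) - wint (\<alpha> - 2) t (X * (X * (D * f))))"
    using wint_X_X[OF t_pos, of "\<alpha> - 2" "D * f"] by simp
  also have "\<dots> = wint (\<alpha> - 2) t (smult (2 * t) (D - X * (X * D)) * f)"
    by (simp add: algebra_simps wint_diff t_pos)
  also have "\<dots> = R n * wint (\<alpha> - 2) t (X * (e n * f)) - r n * wint (\<alpha> - 2) t (P n t * f)"
    unfolding coeff_deriv_ladder[OF assms] by (simp add: algebra_simps wint_diff t_pos)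
  finally show ?thesis .
qed

lemma wint_coeff_deriv_p_shift:
  assumes "coeff_deriv (P n) D t"
  shows "(2 * t)\<^sup>2 * wint (\<alpha> - 1) t (D * P n t) =
     h n t * (R n * (real n - \<alpha> * r n / t) - r n * (2 * real n + 1 + 2 * \<alpha> + R n - \<alpha> * R n / t))"
proof -
  have "(2 * t)\<^sup>2 * wint (\<alpha> - 1) t (D * P n t) = 2 * t * (2 * t * wint (\<alpha> - 1) t (D * P n t))"
    by (simp add: power2_eq_square)
  also have "\<dots> = R n * (2 * t * wint (\<alpha> - 2) t (X * (P n t * e n)))
      - r n * (2 * t * wint (\<alpha> - 2) t (P n t * P n t))"
    unfolding wint_coeff_deriv_shift[OF assms] by (simp add: algebra_simps)
  finally show ?thesis
    unfolding wint_X_p_e_shift2 wint_p_p_shift2 by (simp add: algebra_simps)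
qed

text \<open>Both integrals are multiples of the value of \<open>D\<close> at 1. Comparing them
  eliminates that value.\<close>

lemma wint_coeff_deriv_proportional:
  assumes "coeff_deriv (P m) D t"
  shows "R m * wint (\<alpha> - 1) t (X * (P (Suc m) t * D)) = r (Suc m) * wint (\<alpha> - 1) t (D * P m t)"
proof -
  let ?p = "P (Suc m) t" and ?q = "P m t"
  note deg_below_D = deg_below_mono[OF deg_below_coeff_deriv[OF assms]] and parity_D = has_parity_coeff_deriv[OF assms]
  have "wint (\<alpha> - 1) t (?p * (X * D)) * poly (X * ?q) 1 = wint (\<alpha> - 1) t (?p * (X * ?q)) * poly (X * D) 1"
    by (intro wint_shift_proportional has_parity_X parity_D has_parity_p)
       (auto intro!: deg_below_X deg_below_p deg_below_D)
  then have 1: "wint (\<alpha> - 1) t (X * (?p * D)) * poly ?q 1 = wint (\<alpha> - 1) t (X * (?p * ?q)) * poly D 1"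
    by (simp add: mult.left_commute)
  have 2: "wint (\<alpha> - 1) t (?q * D) * poly ?q 1 = wint (\<alpha> - 1) t (?q * ?q) * poly D 1"
    by (intro wint_shift_proportional parity_D has_parity_p) (auto intro!: deg_below_p deg_below_D)
  have "(h m t * R m) * wint (\<alpha> - 1) t (X * (?p * D)) * poly ?q 1
      = (h m t * r (Suc m)) * wint (\<alpha> - 1) t (?q * D) * poly ?q 1"
    unfolding wint_p_p_shift[of m, symmetric] wint_X_p_p_shift[symmetric] using 1 2 by algebra
  then show ?thesis
    using p_at_1_nonzero[of m] by (simp add: mult.commute)
qed

text \<open>The ladder relation for \<open>P m\<close> with test polynomial
  \<open>X * P (Suc m) t\<close>; \<open>e m\<close> is expanded by its definition and
  \<open>r m\<close> eliminated by \<open>r_add_r_Suc\<close>.\<close>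

lemma wint_X_p_coeff_deriv_q:
  assumes "coeff_deriv (P m) D t"
  shows "(2 * t)\<^sup>2 * wint (\<alpha> - 1) t (X * (P (Suc m) t * D)) =
    h m t * ((r (Suc m) + 2 * t) * (real (Suc m) - \<alpha> * r (Suc m) / t) - R m * r (Suc m))
    - R m * h (Suc m) t * (2 * real (Suc m) + 1 + 2 * \<alpha> - \<alpha> * R (Suc m) / t)"
proof -
  let ?p = "P (Suc m) t" and ?q = "P m t"
  have X2: "2 * t * wint (\<alpha> - 2) t (X * (X * f)) = 2 * t * wint (\<alpha> - 2) t f - 2 * t * wint (\<alpha> - 1) t f" for f
    using wint_X_X[OF t_pos, of "\<alpha> - 2" f] by (simp add: right_diff_distrib)
  have "2 * t * wint (\<alpha> - 2) t (X * (e m * (X * ?p))) =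
      2 * t * wint (\<alpha> - 2) t (X * (X * (X * (?p * ?q)))) - 2 * t * wint (\<alpha> - 2) t (X * (X * (?p * ?p)))"
    by (simp add: e_def algebra_simps wint_diff t_pos)
  then have e: "2 * t * wint (\<alpha> - 2) t (X * (e m * (X * ?p))) =
      h m t * (real (Suc m) - \<alpha> * r (Suc m) / t) - h m t * r (Suc m)
      - (h (Suc m) t * (2 * real (Suc m) + 1 + 2 * \<alpha> + R (Suc m) - \<alpha> * R (Suc m) / t) - h (Suc m) t * R (Suc m))"
    unfolding X2 wint_p_p_shift2 wint_X_p_p_shift2 wint_p_p_shift wint_X_p_p_shift by simp
  have "(2 * t)\<^sup>2 * wint (\<alpha> - 1) t (X * (?p * D)) = 2 * t * (2 * t * wint (\<alpha> - 1) t (D * (X * ?p)))"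
    by (simp add: power2_eq_square mult_ac)
  also have "\<dots> = R m * (2 * t * wint (\<alpha> - 2) t (X * (e m * (X * ?p))))
      - r m * (2 * t * wint (\<alpha> - 2) t (X * (?p * ?q)))"
    unfolding wint_coeff_deriv_shift[OF assms] by (simp add: algebra_simps)
  finally have step: "(2 * t)\<^sup>2 * wint (\<alpha> - 1) t (X * (?p * D)) =
      R m * (2 * t * wint (\<alpha> - 2) t (X * (e m * (X * ?p))))
      - r m * (2 * t * wint (\<alpha> - 2) t (X * (?p * ?q)))" .
  \<comment> \<open>With \<open>c\<close> in place of the quotient, all identities are polynomial
    and fit \<open>algebra\<close>.\<close>
  define c where "c = \<alpha> / t"
  have frac: "\<alpha> * x / t = c * x" for x by (simp add: c_def)
  have "\<alpha> = c * t" using t_positive by (simp add: c_def)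
  then show ?thesis
    using step e[unfolded frac] wint_X_p_p_shift2[of m, unfolded frac] r_add_r_Suc[of m] r_quadratic[of m]
    unfolding frac by algebra
qed

text \<open>The ladder relation for \<open>P (Suc m)\<close> with test polynomial
  \<open>X * P m t\<close>; here \<open>e_Suc\<close> leaves only squares of
  \<open>P m t\<close>.\<close>

lemma wint_X_q_coeff_deriv_p:
  assumes "coeff_deriv (P (Suc m)) D t"
  shows "(2 * t)\<^sup>2 * wint (\<alpha> - 1) t (X * (D * P m t)) =
    R (Suc m) * h (Suc m) t * (2 * real m + 1 + 2 * \<alpha> - \<alpha> * R m / t)
    - r (Suc m) * h m t * (real (Suc m) - \<alpha> * r (Suc m) / t)"
proof -
  let ?p = "P (Suc m) t" and ?q = "P m t"
  have "2 * t * wint (\<alpha> - 2) t (X * (e (Suc m) * (X * ?q))) =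
      h (Suc m) t / h m t * (2 * t * wint (\<alpha> - 2) t (X * (X * (?q * ?q))))"
    by (simp add: e_Suc mult_ac)
  also have "2 * t * wint (\<alpha> - 2) t (X * (X * (?q * ?q))) =
      2 * t * wint (\<alpha> - 2) t (?q * ?q) - 2 * t * wint (\<alpha> - 1) t (?q * ?q)"
    using wint_X_X[OF t_pos, of "\<alpha> - 2" "?q * ?q"] by (simp add: right_diff_distrib)
  also have "h (Suc m) t / h m t * \<dots> = h (Suc m) t * (2 * real m + 1 + 2 * \<alpha> - \<alpha> * R m / t)"
    unfolding wint_p_p_shift2 wint_p_p_shift by (simp add: field_simps)
  finally have e: "2 * t * wint (\<alpha> - 2) t (X * (e (Suc m) * (X * ?q))) =
    h (Suc m) t * (2 * real m + 1 + 2 * \<alpha> - \<alpha> * R m / t)" .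
  have "(2 * t)\<^sup>2 * wint (\<alpha> - 1) t (X * (D * ?q)) = 2 * t * (2 * t * wint (\<alpha> - 1) t (D * (X * ?q)))"
    by (simp add: power2_eq_square mult_ac)
  also have "\<dots> = R (Suc m) * (2 * t * wint (\<alpha> - 2) t (X * (e (Suc m) * (X * ?q))))
      - r (Suc m) * (2 * t * wint (\<alpha> - 2) t (X * (?p * ?q)))"
    unfolding wint_coeff_deriv_shift[OF assms] by (simp add: algebra_simps)
  finally show ?thesis
    unfolding e wint_X_p_p_shift2 by (simp add: algebra_simps)
qed

text \<open>The integral of \<open>X * P (Suc m) t\<close> times the derivative of
  \<open>P m\<close> is known directly from \<open>wint_X_p_coeff_deriv_q\<close> and, up to the
  factor \<open>R m\<close>, from \<open>wint_coeff_deriv_proportional\<close>. Equating the two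
  gives the relation.\<close>

lemma R_r_compatibility:
  fixes m :: nat
  defines "n \<equiv> real (Suc m)"
  shows "h (Suc m) t * (R (Suc m) * (2 * n - 1 + 2 * \<alpha>) + R m * (2 * n + 1 + 2 * \<alpha>)) =
    h m t * (2 * n * t - (r (Suc m))\<^sup>2 + (2 * n + 2 * \<alpha> - 2 * t) * r (Suc m))"
proof -
  obtain D where D: "coeff_deriv (P m) D t" using ex_coeff_deriv[OF t_positive] by blast
  define c where "c = \<alpha> / t"
  have \<alpha>: "\<alpha> = c * t" using t_positive by (simp add: c_def)
  have m: "real m = n - 1" "real (Suc m) = n" by (simp_all add: n_def)
  have frac: "\<alpha> * x / t = c * x" for x by (simp add: c_def)
  note facts = wint_X_p_coeff_deriv_q[OF D, unfolded m frac] wint_coeff_deriv_p_shift[OF D, unfolded m frac]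
    wint_coeff_deriv_proportional[OF D] r_add_r_Suc[of m] r_quadratic[of m]
  \<comment> \<open>The comparison carries the factor \<open>R m\<close>, which is positive and
    cancels.\<close>
  have "R m * (h (Suc m) t * (R (Suc m) * (2 * n - 1 + 2 * \<alpha>) + R m * (2 * n + 1 + 2 * \<alpha>))) =
    R m * (h m t * (2 * n * t - (r (Suc m))\<^sup>2 + (2 * n + 2 * \<alpha> - 2 * t) * r (Suc m)))"
    using facts \<alpha> by algebra
  then show ?thesis using R_pos[of m] by simp
qed

section \<open>The Riccati equations\<close>

text \<open>Stated for every \<open>s\<close>, since \<open>R_aux\<close> is to be differentiated as
  a function.\<close>

lemma R_aux_eq: "R_aux \<alpha> P h n s = 2 * s / h n s * wint (\<alpha> - 1) s (P n s * P n s)"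
proof -
  have "integral {-1..1} (\<lambda>y. 1 / (1 - y\<^sup>2) * (poly (P n s) y)\<^sup>2 * weight \<alpha> y s) =
      wint (\<alpha> - 1) s (P n s * P n s)"
    unfolding wint_def
    by (intro integral_cong) (auto simp: weight_minus_one power2_eq_square[of "poly _ _"])
  then show ?thesis by (simp add: R_aux_def)
qed

lemma r_aux_Suc_eq:
  "r_aux \<alpha> P h (Suc m) s = 2 * s / h m s * wint (\<alpha> - 1) s (X * (P (Suc m) s * P m s))"
proof -
  have "integral {-1..1} (\<lambda>y. y / (1 - y\<^sup>2) * poly (P (Suc m) s) y * poly (P m s) y * weight \<alpha> y s) =
      wint (\<alpha> - 1) s (X * (P (Suc m) s * P m s))"
    unfolding wint_def
    by (intro integral_cong) (auto simp: weight_minus_one)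
  then show ?thesis by (simp add: r_aux_def)
qed

lemma R_aux_eq_R: "R_aux \<alpha> P h n t = R n"
  by (simp add: R_aux_eq R_def)

lemma r_aux_eq_r: "r_aux \<alpha> P h n t = r n"
proof (cases n)
  case 0
  then show ?thesis by (simp add: r_aux_def r_def)
qed (simp add: r_aux_Suc_eq r_def)

text \<open>Quotient and product rule, with \<open>DERIV_h\<close> contributing the summand with
  \<open>R n\<close>. The grouping matches the normalized integrals computed before.\<close>

lemma DERIV_normalized:
  assumes "(f has_real_derivative f') (at t)"
  shows "((\<lambda>s. 2 * s / h n s * f s) has_real_derivative
    (R n * (2 * t * f t / h n t) + 2 * (2 * t * f t / h n t) + (2 * t)\<^sup>2 * f' / h n t) / (2 * t)) (at t)"
proof -
  have "((\<lambda>s. 2 * s) has_real_derivative 2) (at t)"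
    by (auto intro!: derivative_eq_intros)
  from DERIV_mult[OF DERIV_divide[OF this DERIV_h[of n] h_nonzero] assms] show ?thesis
    by (rule DERIV_cong) (use t_positive in \<open>simp add: field_simps power2_eq_square\<close>)
qed

lemma DERIV_R_aux:
  "(R_aux \<alpha> P h n has_real_derivative
     ((R n)\<^sup>2 + 2 * (real n + \<alpha> + 1 - t) * R n - 2 * r n * (2 * real n + 1 + 2 * \<alpha> + R n)
      - 2 * t * (2 * real n + 1 + 2 * \<alpha>)) / (2 * t)) (at t)"
proof -
  obtain D where D: "coeff_deriv (P n) D t" using ex_coeff_deriv[OF t_positive] by blast
  let ?p = "P n t"
  define W where "W = wint (\<alpha> - 1) t (?p * ?p)"
  define W' where "W' = 2 * wint (\<alpha> - 1) t (D * ?p) - wint (\<alpha> - 2) t (?p * ?p)"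
  have "((\<lambda>s. wint (\<alpha> - 1) s (P n s * P n s)) has_real_derivative
      wint (\<alpha> - 1) t (D * ?p + ?p * D) - wint (\<alpha> - 1 - 1) t (?p * ?p)) (at t)"
    by (rule has_real_derivative_wint_family[OF coeff_deriv_mult[OF D D] t_positive deg_below_P_mult])
  also have "wint (\<alpha> - 1) t (D * ?p + ?p * D) - wint (\<alpha> - 1 - 1) t (?p * ?p) = W'"
    by (simp only: W'_def mult.commute[of ?p D] wint_add t_positive) simp
  finally have "((\<lambda>s. 2 * s / h n s * wint (\<alpha> - 1) s (P n s * P n s)) has_real_derivative
      (R n * (2 * t * W / h n t) + 2 * (2 * t * W / h n t) + (2 * t)\<^sup>2 * W' / h n t) / (2 * t)) (at t)"
    unfolding W_def by (rule DERIV_normalized)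
  also have "(\<lambda>s. 2 * s / h n s * wint (\<alpha> - 1) s (P n s * P n s)) = R_aux \<alpha> P h n"
    by (simp add: R_aux_eq fun_eq_iff)
  also have "2 * t * W / h n t = R n"
    by (simp add: W_def R_def)
  also have "(2 * t)\<^sup>2 * W' / h n t =
      2 * (R n * (real n - \<alpha> * r n / t) - r n * (2 * real n + 1 + 2 * \<alpha> + R n - \<alpha> * R n / t))
      - 2 * t * (2 * real n + 1 + 2 * \<alpha> + R n - \<alpha> * R n / t)"
  proof -
    have "(2 * t)\<^sup>2 * W' = 2 * ((2 * t)\<^sup>2 * wint (\<alpha> - 1) t (D * ?p)) - 2 * t * (2 * t * wint (\<alpha> - 2) t (?p * ?p))"
      by (simp add: W'_def power2_eq_square algebra_simps)
    then show ?thesis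
      unfolding wint_coeff_deriv_p_shift[OF D] wint_p_p_shift2
      by (simp add: diff_divide_distrib)
  qed
  \<comment> \<open>The terms with \<open>\<alpha> * r n * R n / t\<close> cancel.\<close>
  also have "R n * R n + 2 * R n +
      (2 * (R n * (real n - \<alpha> * r n / t) - r n * (2 * real n + 1 + 2 * \<alpha> + R n - \<alpha> * R n / t))
      - 2 * t * (2 * real n + 1 + 2 * \<alpha> + R n - \<alpha> * R n / t)) =
      (R n)\<^sup>2 + 2 * (real n + \<alpha> + 1 - t) * R n - 2 * r n * (2 * real n + 1 + 2 * \<alpha> + R n)
      - 2 * t * (2 * real n + 1 + 2 * \<alpha>)"
    using t_positive by (simp add: field_simps power2_eq_square)
  finally show ?thesis .
qed

text \<open>Three contributions meet: the derivatives of both polynomials and of the weight.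
  \<open>R_r_compatibility\<close> removes the remaining term in
  \<open>h (Suc m) t * R (Suc m)\<close>.\<close>

lemma DERIV_r_aux_Suc:
  fixes m :: nat
  defines "n \<equiv> real (Suc m)"
  shows "(r_aux \<alpha> P h (Suc m) has_real_derivative
     (2 * n * t - (r (Suc m))\<^sup>2 + 2 * (n + \<alpha> + 1 - t) * r (Suc m)
      - 2 * (2 * n + 1 + 2 * \<alpha>) * ((r (Suc m))\<^sup>2 + 2 * t * r (Suc m)) / R (Suc m)) / (2 * t)) (at t)"
proof -
  obtain D E where D: "coeff_deriv (P (Suc m)) D t" and E: "coeff_deriv (P m) E t"
    using ex_coeff_deriv[OF t_positive] by blast
  let ?p = "P (Suc m) t" and ?q = "P m t"
  define V where "V = wint (\<alpha> - 1) t (X * (?p * ?q))"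
  define V' where "V' = wint (\<alpha> - 1) t (X * (D * ?q)) + wint (\<alpha> - 1) t (X * (?p * E)) - wint (\<alpha> - 2) t (X * (?p * ?q))"
  have "deg_below (Suc (Suc m + m + 1)) (X * (P (Suc m) s * P m s))" if "s > 0" for s
    by (intro deg_below_X deg_below_P_mult that)
  from has_real_derivative_wint_family[OF coeff_deriv_mult[OF coeff_deriv_const coeff_deriv_mult[OF D E]] t_positive this, where a = "\<alpha> - 1"]
  have "((\<lambda>s. wint (\<alpha> - 1) s (X * (P (Suc m) s * P m s))) has_real_derivative V') (at t)"
    by (simp add: V'_def distrib_left wint_add t_positive)
  then have "((\<lambda>s. 2 * s / h m s * wint (\<alpha> - 1) s (X * (P (Suc m) s * P m s))) has_real_derivative
      (R m * (2 * t * V / h m t) + 2 * (2 * t * V / h m t) + (2 * t)\<^sup>2 * V' / h m t) / (2 * t)) (at t)"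
    unfolding V_def by (rule DERIV_normalized)
  also have "(\<lambda>s. 2 * s / h m s * wint (\<alpha> - 1) s (X * (P (Suc m) s * P m s))) = r_aux \<alpha> P h (Suc m)"
    by (simp add: r_aux_Suc_eq fun_eq_iff)
  also have "2 * t * V / h m t = r (Suc m)"
    by (simp add: V_def r_def)
  also have "R m * r (Suc m) + 2 * r (Suc m) + (2 * t)\<^sup>2 * V' / h m t =
      2 * n * t - (r (Suc m))\<^sup>2 + 2 * (n + \<alpha> + 1 - t) * r (Suc m)
      - 2 * (2 * n + 1 + 2 * \<alpha>) * ((r (Suc m))\<^sup>2 + 2 * t * r (Suc m)) / R (Suc m)"
  proof -
    define c where "c = \<alpha> / t"
    have \<alpha>: "\<alpha> = c * t" using t_positive by (simp add: c_def)
    have m: "real m = n - 1" "real (Suc m) = n" by (simp_all add: n_def)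
    have frac: "\<alpha> * x / t = c * x" for x by (simp add: c_def)
    have V': "(2 * t)\<^sup>2 * V' = (2 * t)\<^sup>2 * wint (\<alpha> - 1) t (X * (D * ?q))
        + (2 * t)\<^sup>2 * wint (\<alpha> - 1) t (X * (?p * E)) - 2 * t * (2 * t * wint (\<alpha> - 2) t (X * (?p * ?q)))"
      by (simp add: V'_def power2_eq_square algebra_simps)
    \<comment> \<open>By \<open>r_quadratic\<close> the fraction in the Riccati equation is
      \<open>R m\<close> times the recurrence coefficient.\<close>
    have quot: "((r (Suc m))\<^sup>2 + 2 * t * r (Suc m)) / R (Suc m) = h (Suc m) t * R m / h m t"
      using r_quadratic[of m] R_pos[of "Suc m"] by (simp add: field_simps power2_eq_square)
    have "h m t * (R m * r (Suc m) + 2 * r (Suc m)) + (2 * t)\<^sup>2 * V' =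
      h m t * (2 * n * t - (r (Suc m))\<^sup>2 + 2 * (n + \<alpha> + 1 - t) * r (Suc m))
      - 2 * (2 * n + 1 + 2 * \<alpha>) * (h (Suc m) t * R m)"
      using V' wint_X_p_coeff_deriv_q[OF E, unfolded m frac] wint_X_q_coeff_deriv_p[OF D, unfolded m frac]
        wint_X_p_p_shift2[of m, unfolded m frac] R_r_compatibility[of m, folded n_def] r_quadratic[of m] \<alpha>
      by algebra
    then show ?thesis
      unfolding times_divide_eq_right[symmetric] quot by (simp add: field_simps)
  qed
  finally show ?thesis .
qed

end

theorem lemma3p1:
  fixes \<alpha> t :: real and n :: nat
    and P :: "nat \<Rightarrow> real \<Rightarrow> real poly" and h r R :: "nat \<Rightarrow> real \<Rightarrow> real"
  assumes "\<alpha> > 0"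
    and "\<And>s. s > 0 \<Longrightarrow> monic_orthogonal \<alpha> s (\<lambda>k. P k s) (\<lambda>k. h k s)"
    and "r = r_aux \<alpha> P h" and "R = R_aux \<alpha> P h"
    and "t > 0"
  shows "r n field_differentiable (at t) \<and> R n field_differentiable (at t) \<and>
    2 * t * deriv (r n) t =
      2 * real n * t - (r n t)\<^sup>2 + 2 * (real n + \<alpha> + 1 - t) * r n t
      - 2 * (2 * real n + 1 + 2 * \<alpha>) * ((r n t)\<^sup>2 + 2 * t * r n t) / R n t \<and>
    2 * t * deriv (R n) t =
      (R n t)\<^sup>2 + 2 * (real n + \<alpha> + 1 - t) * R n t
      - 2 * r n t * (2 * real n + 1 + 2 * \<alpha> + R n t)
      - 2 * t * (2 * real n + 1 + 2 * \<alpha>)"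
proof -
  interpret F: monic_orthogonal_family_at \<alpha> P h t
    by unfold_locales (use assms(2,5) in auto)
  have vals: "F.R n = R n t" "F.r n = r n t"
    by (simp_all add: assms(3,4) F.R_aux_eq_R F.r_aux_eq_r)
  note dR = F.DERIV_R_aux[of n, folded assms(4), unfolded vals]
  have dr: "(r n has_real_derivative
     (2 * real n * t - (r n t)\<^sup>2 + 2 * (real n + \<alpha> + 1 - t) * r n t
      - 2 * (2 * real n + 1 + 2 * \<alpha>) * ((r n t)\<^sup>2 + 2 * t * r n t) / R n t) / (2 * t)) (at t)"
  proof (cases n)
    \<comment> \<open>Here \<open>r n\<close> is the zero function, and every term on the right
      contains \<open>n\<close> or \<open>r n t\<close>.\<close>
    case 0
    then have "r n = (\<lambda>_. 0)" by (simp add: assms(3) r_aux_def fun_eq_iff)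
    then show ?thesis using 0 by simp
  next
    case (Suc m)
    show ?thesis
      using F.DERIV_r_aux_Suc[of m, folded Suc assms(3), unfolded vals] .
  qed
  show ?thesis
    using DERIV_imp_deriv[OF dr] DERIV_imp_deriv[OF dR] dr dR assms(5)
    by (auto simp: field_differentiable_def)
qed

end
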